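(* Let $A$ and $B$ be sets and let $\phi\subseteq A\times B$ be a relation from $A$ to $B$. Then $\phi$ is regular if, and only if, the complete lattice $\mathcal{K}\phi$ is constructively completely distributive (ccd).
   Context: A relation $\phi\subseteq A\times B$ (write $x\phi y$ for $(x,y)\in\phi$) is regular if it is a regular arrow in the category of sets and relations, i.e. there is a relation $\psi\subseteq B\times A$ with $\phi\circ\psi\circ\phi=\phi$ (relational composition). For $V\subseteq B$ and $U\subseteq A$ put $\phi^*V=\{x\in A\mid \exists y\in V:\ x\phi y\}$ and $\phi_*U=\{y\in B\mid \forall x\in A:\ x\phi y\Rightarrow x\in U\}$. Then $\mathcal{K}\phi:=\{V\subseteq B\mid \phi_*\phi^*V=V\}$, ordered by inclusion; it is a complete lattice. A complete lattice $L$ is constructively completely distributive, (ccd), if the monotone map $\sup:\mathcal{P}L\to L$ sending each down set of $L$ to its supremum has a left adjoint in the 2-category of ordered sets and monotone maps, where $\mathcal{P}L$ is the set of down sets of $L$ ordered by inclusion. *)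

theory Defs
  imports "HOL-Algebra.Galois_Connection"
begin

definition regular_rel :: "'a set \<Rightarrow> 'b set \<Rightarrow> ('a \<times> 'b) set \<Rightarrow> bool" where
  "regular_rel A B \<phi> \<longleftrightarrow> (\<exists>\<psi>. \<psi> \<subseteq> B \<times> A \<and> \<phi> O \<psi> O \<phi> = \<phi>)"

definition rel_upper_star :: "'a set \<Rightarrow> ('a \<times> 'b) set \<Rightarrow> 'b set \<Rightarrow> 'a set" where
  "rel_upper_star A \<phi> V = {x \<in> A. \<exists>y\<in>V. (x, y) \<in> \<phi>}"

definition rel_lower_star :: "'a set \<Rightarrow> 'b set \<Rightarrow> ('a \<times> 'b) set \<Rightarrow> 'a set \<Rightarrow> 'b set" where
  "rel_lower_star A B \<phi> U = {y \<in> B. \<forall>x\<in>A. (x, y) \<in> \<phi> \<longrightarrow> x \<in> U}"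

definition K_lattice :: "'a set \<Rightarrow> 'b set \<Rightarrow> ('a \<times> 'b) set \<Rightarrow> 'b set gorder" where
  "K_lattice A B \<phi> =
     \<lparr>carrier = {V. V \<subseteq> B \<and> rel_lower_star A B \<phi> (rel_upper_star A \<phi> V) = V},
      eq = (=), le = (\<subseteq>)\<rparr>"

definition down_sets :: "('a, 'c) gorder_scheme \<Rightarrow> 'a set gorder" where
  "down_sets L =
     \<lparr>carrier = {D. D \<subseteq> carrier L \<and> (\<forall>x\<in>D. \<forall>y\<in>carrier L. y \<sqsubseteq>\<^bsub>L\<^esub> x \<longrightarrow> y \<in> D)},
      eq = (=), le = (\<subseteq>)\<rparr>"

text \<open>The supremum map goes from \<open>down_sets L\<close> to \<open>L\<close>; that it \<^emph>\<open>has\<close> a left adjoint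
  means that it \<^emph>\<open>is\<close> an upper (right) adjoint, with lower adjoint \<open>L \<rightarrow> down_sets L\<close>.
  Adjunctions between ordered sets are Galois connections, whose two maps are
  automatically monotone.\<close>

definition ccd :: "('a, 'c) gorder_scheme \<Rightarrow> bool" where
  "ccd L \<longleftrightarrow> complete_lattice L \<and> upper_adjoint L (down_sets L) (\<lambda>D. \<Squnion>\<^bsub>L\<^esub>D)"

lemma partial_order_down_sets: "partial_order (down_sets L)"
  by standard (auto simp: down_sets_def)

lemma (in complete_lattice) isotone_sup_down_sets:
  "isotone (down_sets L) L (\<lambda>D. \<Squnion>D)"
proof (rule isotoneI)
  show "weak_partial_order (down_sets L)"
    using partial_order_down_sets partial_order_def by blast
  show "weak_partial_order L" ..
  fix D E
  assume "D \<in> carrier (down_sets L)" "E \<in> carrier (down_sets L)" "D \<sqsubseteq>\<^bsub>down_sets L\<^esub> E"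
  then have "D \<subseteq> carrier L" "E \<subseteq> carrier L" "D \<subseteq> E"
    by (auto simp: down_sets_def)
  then show "\<Squnion>D \<sqsubseteq> \<Squnion>E"
    by (meson subset_iff weak.sup_closed weak.sup_least weak.sup_upper)
qed

lemma complete_lattice_K_lattice: "complete_lattice (K_lattice A B \<phi>)"
proof -
  let ?L = "K_lattice A B \<phi>"
  let ?c = "\<lambda>V. rel_lower_star A B \<phi> (rel_upper_star A \<phi> V)"
  have mono: "?c V \<subseteq> ?c V'" if "V \<subseteq> V'" for V V'
    using that unfolding rel_lower_star_def rel_upper_star_def by blast
  have infl: "V \<subseteq> ?c V" if "V \<subseteq> B" for V
    using that unfolding rel_lower_star_def rel_upper_star_def by blast
  have idem: "?c (?c V) = ?c V" for V
    unfolding rel_lower_star_def rel_upper_star_def by blast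
  have sub: "?c V \<subseteq> B" for V
    unfolding rel_lower_star_def by blast
  have carr: "V \<in> carrier ?L \<longleftrightarrow> V \<subseteq> B \<and> ?c V = V" for V
    by (simp add: K_lattice_def)
  have le: "V \<sqsubseteq>\<^bsub>?L\<^esub> V' \<longleftrightarrow> V \<subseteq> V'" for V V'
    by (simp add: K_lattice_def)
  have po: "partial_order ?L"
    by standard (auto simp: K_lattice_def)
  show ?thesis
  proof (rule partial_order.complete_latticeI[OF po])
    fix W
    assume W: "W \<subseteq> carrier ?L"
    have "least ?L (?c (\<Union>W)) (Upper ?L W)"
    proof (rule least_UpperI)
      fix V
      assume "V \<in> W"
      moreover have "\<Union>W \<subseteq> ?c (\<Union>W)"
        using W carr by (intro infl) blast
      ultimately show "V \<sqsubseteq>\<^bsub>?L\<^esub> ?c (\<Union>W)"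
        unfolding le by blast
    next
      fix V
      assume "V \<in> Upper ?L W"
      then have "V \<in> carrier ?L" "\<Union>W \<subseteq> V"
        using W unfolding Upper_def le by blast+
      then show "?c (\<Union>W) \<sqsubseteq>\<^bsub>?L\<^esub> V"
        using mono[of "\<Union>W" V] unfolding le carr by simp
    next
      show "?c (\<Union>W) \<in> carrier ?L"
        using carr idem sub by simp
    qed (rule W)
    then show "\<exists>s. least ?L s (Upper ?L W)" ..
  next
    fix W
    assume W: "W \<subseteq> carrier ?L"
    have "?c (\<Inter>W \<inter> B) \<subseteq> V" if "V \<in> W" for V
      using mono[of "\<Inter>W \<inter> B" V] that W carr by blast
    then have "?c (\<Inter>W \<inter> B) = \<Inter>W \<inter> B"
      using infl[of "\<Inter>W \<inter> B"] sub[of "\<Inter>W \<inter> B"] by blast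
    then have inf_in: "\<Inter>W \<inter> B \<in> carrier ?L"
      by (simp add: carr)
    have "greatest ?L (\<Inter>W \<inter> B) (Lower ?L W)"
    proof (rule greatest_LowerI)
      show "\<Inter>W \<inter> B \<sqsubseteq>\<^bsub>?L\<^esub> V" if "V \<in> W" for V
        using that unfolding le by blast
    next
      fix V
      assume "V \<in> Lower ?L W"
      then have "V \<in> carrier ?L" "V \<subseteq> \<Inter>W"
        using W unfolding Lower_def le by blast+
      then show "V \<sqsubseteq>\<^bsub>?L\<^esub> \<Inter>W \<inter> B"
        unfolding le carr by simp
    qed (rule W inf_in)+
    then show "\<exists>i. greatest ?L i (Lower ?L W)" ..
  qed
qed

end

(*
  Up to isomorphism K phi is the lattice of all sets phi^* V, in which suprema are unions. Call
  (b, a) good if every y with a phi y satisfies phi^*{b} <= phi^*{y}. The good pairs form the largest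
  psi with phi o psi o phi <= phi, so phi is regular iff for all x phi y there is a good (b, a) with
  x phi b and a phi y. If this holds, the left adjoint of sup sends W to the down set generated by
  the closures of those b which are in a good pair (b, a) with a in phi^* W. Conversely, if sup has
  a left adjoint f, apply f to the closure of {y} to find b, and apply the adjunction to the down
  set generated by the closures of all points z with not phi^*{b} <= phi^*{z} to find a.
*)
theory Submission
  imports Defs
begin

lemma carrier_K_lattice:
  "V \<in> carrier (K_lattice A B \<phi>) \<longleftrightarrow>
     V \<subseteq> B \<and> rel_lower_star A B \<phi> (rel_upper_star A \<phi> V) = V"
  by (simp add: K_lattice_def)

lemma le_K_lattice [simp]: "V \<sqsubseteq>\<^bsub>K_lattice A B \<phi>\<^esub> W \<longleftrightarrow> V \<subseteq> W"
  by (simp add: K_lattice_def)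

lemma carrier_down_sets:
  "D \<in> carrier (down_sets L) \<longleftrightarrow>
     D \<subseteq> carrier L \<and> (\<forall>x\<in>D. \<forall>y\<in>carrier L. y \<sqsubseteq>\<^bsub>L\<^esub> x \<longrightarrow> y \<in> D)"
  by (simp add: down_sets_def)

lemma le_down_sets [simp]: "D \<sqsubseteq>\<^bsub>down_sets L\<^esub> E \<longleftrightarrow> D \<subseteq> E"
  by (simp add: down_sets_def)

text \<open>Both sides say that every point of \<open>A\<close> related to a point of
  \<open>V\<close> lies in \<open>U\<close>. The closure operator defining the lattice is the
  composite of this adjoint pair.\<close>

lemma rel_star_galois:
  "V \<subseteq> B \<Longrightarrow> V \<subseteq> rel_lower_star A B \<phi> U \<longleftrightarrow> rel_upper_star A \<phi> V \<subseteq> U"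
  unfolding rel_lower_star_def rel_upper_star_def by blast

lemma rel_lower_star_mono: "U \<subseteq> U' \<Longrightarrow> rel_lower_star A B \<phi> U \<subseteq> rel_lower_star A B \<phi> U'"
  unfolding rel_lower_star_def by blast

lemma rel_upper_star_mono: "V \<subseteq> V' \<Longrightarrow> rel_upper_star A \<phi> V \<subseteq> rel_upper_star A \<phi> V'"
  unfolding rel_upper_star_def by blast

text \<open>Triangle identity of the adjunction. It supplies closures, such as that of a single
  point, as lattice elements.\<close>

lemma rel_lower_star_in_K_lattice:
  "rel_lower_star A B \<phi> U \<in> carrier (K_lattice A B \<phi>)"
  unfolding carrier_K_lattice rel_lower_star_def rel_upper_star_def by blast

text \<open>A closed \<open>W\<close> is itself a value of \<open>rel_lower_star\<close>, so the
  adjunction applies. Hence \<open>rel_upper_star\<close> embeds the lattice, as an ordered set,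
  into the subsets of \<open>A\<close>.\<close>

lemma subset_K_lattice_iff:
  assumes "V \<subseteq> B" and "W \<in> carrier (K_lattice A B \<phi>)"
  shows "V \<subseteq> W \<longleftrightarrow> rel_upper_star A \<phi> V \<subseteq> rel_upper_star A \<phi> W"
  using assms rel_star_galois[of V B A \<phi> "rel_upper_star A \<phi> W"]
  by (simp add: carrier_K_lattice)

lemma sup_K_lattice:
  assumes "D \<subseteq> carrier (K_lattice A B \<phi>)"
  shows "\<Squnion>\<^bsub>K_lattice A B \<phi>\<^esub> D = rel_lower_star A B \<phi> (rel_upper_star A \<phi> (\<Union>D))"
    (is "?s = ?c")
proof
  interpret complete_lattice "K_lattice A B \<phi>"
    by (rule complete_lattice_K_lattice)
  have sub: "\<Union>D \<subseteq> B"
    using assms unfolding K_lattice_def by auto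
  have "\<Union>D \<subseteq> ?c"
    using sub by (simp add: rel_star_galois)
  then show "?s \<subseteq> ?c"
    using weak.sup_least[OF assms rel_lower_star_in_K_lattice] by (simp add: Sup_le_iff)
  have s: "?s \<in> carrier (K_lattice A B \<phi>)"
    using assms by simp
  have "\<Union>D \<subseteq> ?s"
    using weak.sup_upper[OF assms] by (simp add: Sup_le_iff)
  then have "?c \<subseteq> rel_lower_star A B \<phi> (rel_upper_star A \<phi> ?s)"
    by (intro rel_lower_star_mono rel_upper_star_mono)
  then show "?c \<subseteq> ?s"
    using s by (simp add: carrier_K_lattice)
qed

text \<open>Under this embedding suprema become unions, so the closure taken in the supremum
  disappears. Both directions of the theorem use the adjunction in this form.\<close>

lemma subset_sup_K_lattice_iff:
  assumes "D \<subseteq> carrier (K_lattice A B \<phi>)" and "W \<subseteq> B"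
  shows "W \<subseteq> \<Squnion>\<^bsub>K_lattice A B \<phi>\<^esub> D \<longleftrightarrow>
    rel_upper_star A \<phi> W \<subseteq> rel_upper_star A \<phi> (\<Union>D)"
  using assms by (simp add: sup_K_lattice rel_star_galois)

lemma regular_rel_imp_ccd:
  assumes phi: "\<phi> \<subseteq> A \<times> B" and reg: "regular_rel A B \<phi>"
  shows "ccd (K_lattice A B \<phi>)"
proof -
  let ?L = "K_lattice A B \<phi>"
  let ?u = "rel_upper_star A \<phi>"
  interpret complete_lattice ?L
    by (rule complete_lattice_K_lattice)
  obtain \<psi> where psi: "\<phi> O \<psi> O \<phi> = \<phi>"
    using reg unfolding regular_rel_def by blast
  \<comment> \<open>The two inclusions of the equation for \<open>\<psi>\<close> serve the two
    halves of the adjunction: \<open>factor\<close> gives its unit \<open>f_sup\<close>, while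
    \<open>compose\<close> says that every pair in \<open>\<psi>\<close> is good.\<close>
  have factor: "\<exists>b a. (x, b) \<in> \<phi> \<and> (b, a) \<in> \<psi> \<and> (a, y) \<in> \<phi>" if "(x, y) \<in> \<phi>" for x y
    using that by (subst (asm) psi[symmetric]) blast
  have compose: "(x, y) \<in> \<phi>" if "(x, b) \<in> \<phi>" "(b, a) \<in> \<psi>" "(a, y) \<in> \<phi>" for x b a y
    using that by (subst psi[symmetric]) blast
  define f where "f W =
    {V \<in> carrier ?L. \<exists>b a. b \<in> B \<and> (b, a) \<in> \<psi> \<and> a \<in> ?u W \<and> ?u V \<subseteq> ?u {b}}" for W
  have f_down: "f W \<in> carrier (down_sets ?L)" for W
    unfolding carrier_down_sets le_K_lattice
  proof (intro conjI ballI impI)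
    show "f W \<subseteq> carrier ?L"
      unfolding f_def by simp
    fix V V' assume "V \<in> f W" "V' \<in> carrier ?L" "V' \<subseteq> V"
    then show "V' \<in> f W"
      unfolding f_def using rel_upper_star_mono[of V' V A \<phi>] by fast
  qed
  have f_sup: "?u W \<subseteq> ?u (\<Union>(f W))" for W
  proof
    fix x assume x: "x \<in> ?u W"
    then obtain y where y: "y \<in> W" "(x, y) \<in> \<phi>" "x \<in> A"
      unfolding rel_upper_star_def by blast
    then obtain b a where ba: "(x, b) \<in> \<phi>" "(b, a) \<in> \<psi>" "(a, y) \<in> \<phi>"
      using factor by blast
    \<comment> \<open>The closure of \<open>b\<close> is the largest lattice element
      \<open>V\<close> with \<open>?u V \<subseteq> ?u {b}\<close>, hence the natural witness in
      \<open>f W\<close>.\<close>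
    let ?V = "rel_lower_star A B \<phi> (?u {b})"
    have b: "b \<in> B" and "a \<in> ?u W"
      using ba y phi unfolding rel_upper_star_def by blast+
    moreover have "?u ?V \<subseteq> ?u {b}"
      unfolding rel_lower_star_def rel_upper_star_def by blast
    ultimately have "?V \<in> f W"
      using ba rel_lower_star_in_K_lattice unfolding f_def by blast
    moreover have "b \<in> ?V"
      using b rel_star_galois[of "{b}" B A \<phi> "?u {b}"] by simp
    ultimately show "x \<in> ?u (\<Union>(f W))"
      using y ba unfolding rel_upper_star_def by blast
  qed
  have "galois_connection
    \<lparr>orderA = ?L, orderB = down_sets ?L, lower = f, upper = \<lambda>D. \<Squnion>\<^bsub>?L\<^esub>D\<rparr>"
  proof (unfold galois_connection_def connection_def galois_connection_axioms_def galcon.select_convs,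
      intro conjI allI impI)
    show "partial_order ?L"
      by (rule partial_order_axioms)
    show "partial_order (down_sets ?L)"
      by (rule partial_order_down_sets)
    show "f \<in> carrier ?L \<rightarrow> carrier (down_sets ?L)"
      using f_down by blast
    show "(\<lambda>D. \<Squnion>\<^bsub>?L\<^esub>D) \<in> carrier (down_sets ?L) \<rightarrow> carrier ?L"
      by (auto simp: carrier_down_sets)
    fix W D
    assume W: "W \<in> carrier ?L" and D: "D \<in> carrier (down_sets ?L)"
    have DL: "D \<subseteq> carrier ?L" and WB: "W \<subseteq> B"
      using D W by (simp_all add: carrier_down_sets carrier_K_lattice)
    have "f W \<subseteq> D \<longleftrightarrow> ?u W \<subseteq> ?u (\<Union>D)"
    proof
      assume "f W \<subseteq> D"
      then have "?u (\<Union>(f W)) \<subseteq> ?u (\<Union>D)"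
        by (intro rel_upper_star_mono) blast
      with f_sup show "?u W \<subseteq> ?u (\<Union>D)"
        by blast
    next
      assume le: "?u W \<subseteq> ?u (\<Union>D)"
      show "f W \<subseteq> D"
      proof
        fix V assume "V \<in> f W"
        then obtain b a where V: "V \<in> carrier ?L" and ba: "(b, a) \<in> \<psi>" "a \<in> ?u W" "?u V \<subseteq> ?u {b}"
          unfolding f_def by blast
        then obtain V' v where V': "V' \<in> D" "v \<in> V'" "(a, v) \<in> \<phi>"
          using le unfolding rel_upper_star_def by blast
        \<comment> \<open>Goodness of \<open>(b, a)\<close>: everything related to \<open>b\<close>
          is related to any \<open>v\<close> with \<open>(a, v)\<close> in \<open>\<phi>\<close>. So
          one member \<open>V'\<close> of \<open>D\<close> already lies above \<open>V\<close>, and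
          \<open>D\<close> is a down set.\<close>
        have "?u {b} \<subseteq> ?u {v}"
          using ba(1) V'(3) compose unfolding rel_upper_star_def by blast
        also have "?u {v} \<subseteq> ?u V'"
          using V' by (intro rel_upper_star_mono) simp
        finally have "?u V \<subseteq> ?u V'"
          using ba by blast
        then have "V \<subseteq> V'"
          using V V'(1) DL subset_K_lattice_iff[of V B V' A \<phi>] by (auto simp: K_lattice_def)
        then show "V \<in> D"
          using D V V'(1) unfolding carrier_down_sets by simp
      qed
    qed
    then show "f W \<sqsubseteq>\<^bsub>down_sets ?L\<^esub> D \<longleftrightarrow> W \<sqsubseteq>\<^bsub>?L\<^esub> \<Squnion>\<^bsub>?L\<^esub>D"
      by (simp add: subset_sup_K_lattice_iff[OF DL WB])
  qed
  then show ?thesis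
    unfolding ccd_def upper_adjoint_def using complete_lattice_K_lattice by blast
qed

lemma ccd_imp_regular_rel:
  assumes phi: "\<phi> \<subseteq> A \<times> B" and ccd: "ccd (K_lattice A B \<phi>)"
  shows "regular_rel A B \<phi>"
proof -
  let ?L = "K_lattice A B \<phi>"
  let ?u = "rel_upper_star A \<phi>"
  let ?cl = "\<lambda>y. rel_lower_star A B \<phi> (?u {y})"
  obtain f where "galois_connection
      \<lparr>orderA = ?L, orderB = down_sets ?L, lower = f, upper = \<lambda>D. \<Squnion>\<^bsub>?L\<^esub>D\<rparr>"
    using ccd unfolding ccd_def upper_adjoint_def by blast
  then interpret G: galois_connection
    "\<lparr>orderA = ?L, orderB = down_sets ?L, lower = f, upper = \<lambda>D. \<Squnion>\<^bsub>?L\<^esub>D\<rparr>" .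
  have f_iff: "f W \<subseteq> D \<longleftrightarrow> ?u W \<subseteq> ?u (\<Union>D)"
    if W: "W \<in> carrier ?L" and D: "D \<in> carrier (down_sets ?L)" for W D
    using G.galois_property[of W D] W D
    by (simp add: subset_sup_K_lattice_iff carrier_down_sets carrier_K_lattice)
  have cl_in: "y \<in> ?cl y" if "y \<in> B" for y
    using that rel_star_galois[of "{y}" B A \<phi> "?u {y}"] by simp
  have u_cl: "?u (?cl y) \<subseteq> ?u {y}" for y
    unfolding rel_lower_star_def rel_upper_star_def by blast
  \<comment> \<open>All good pairs: with this choice the composite is contained in
    \<open>\<phi>\<close> by construction, and only the factorization of \<open>\<phi>\<close> needs
    the left adjoint.\<close>
  define \<psi> where "\<psi> = {(b, a) \<in> B \<times> A. \<forall>y. (a, y) \<in> \<phi> \<longrightarrow> ?u {b} \<subseteq> ?u {y}}"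
  have "\<exists>b a. (x, b) \<in> \<phi> \<and> (b, a) \<in> \<psi> \<and> (a, y) \<in> \<phi>" if xy: "(x, y) \<in> \<phi>" for x y
  proof -
    have xA: "x \<in> A" and yB: "y \<in> B"
      using xy phi by auto
    have W: "?cl y \<in> carrier ?L"
      by (rule rel_lower_star_in_K_lattice)
    then have "f (?cl y) \<in> carrier (down_sets ?L)"
      using G.lower_closed by simp
    \<comment> \<open>The unit of the adjunction, from \<open>f_iff\<close> with \<open>D\<close>
      taken to be \<open>f (?cl y)\<close>.\<close>
    then have "?u (?cl y) \<subseteq> ?u (\<Union>(f (?cl y)))"
      using f_iff W by blast
    moreover have "x \<in> ?u (?cl y)"
      using xA xy cl_in[OF yB] unfolding rel_upper_star_def by blast
    ultimately obtain V b where b: "V \<in> f (?cl y)" "b \<in> V" "(x, b) \<in> \<phi>"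
      unfolding rel_upper_star_def by blast
    have "\<exists>a\<in>A. (a, y) \<in> \<phi> \<and> (\<forall>z. (a, z) \<in> \<phi> \<longrightarrow> ?u {b} \<subseteq> ?u {z})"
    proof (rule ccontr)
      assume contra: "\<not> ?thesis"
      \<comment> \<open>If no suitable \<open>a\<close> exists, each point related to
        \<open>y\<close> is also related to some \<open>z\<close> with \<open>?u {b}\<close> not
        inside \<open>?u {z}\<close>. The closures of these \<open>z\<close> therefore cover
        \<open>?u {y}\<close>, and the adjunction forces \<open>f (?cl y)\<close>, hence
        \<open>V\<close>, into \<open>D\<close>.\<close>
      define D where "D = {V \<in> carrier ?L. \<exists>z\<in>B. V \<subseteq> ?cl z \<and> \<not> ?u {b} \<subseteq> ?u {z}}"
      have D: "D \<in> carrier (down_sets ?L)"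
        unfolding carrier_down_sets D_def le_K_lattice by blast
      have "?u {y} \<subseteq> ?u (\<Union>D)"
      proof
        fix a assume "a \<in> ?u {y}"
        then have a: "a \<in> A" "(a, y) \<in> \<phi>"
          by (simp_all add: rel_upper_star_def)
        then obtain z where z: "(a, z) \<in> \<phi>" "\<not> ?u {b} \<subseteq> ?u {z}"
          using contra by blast
        then have zB: "z \<in> B"
          using phi by blast
        then have "?cl z \<in> D"
          using z rel_lower_star_in_K_lattice unfolding D_def by blast
        then have "z \<in> \<Union>D"
          using cl_in[OF zB] by blast
        then show "a \<in> ?u (\<Union>D)"
          using a z unfolding rel_upper_star_def by blast
      qed
      then have "f (?cl y) \<subseteq> D"
        using f_iff[OF W D] u_cl by blast
      then obtain z where "b \<in> ?cl z" "\<not> ?u {b} \<subseteq> ?u {z}"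
        using b unfolding D_def by blast
      \<comment> \<open>Membership of \<open>b\<close> in the closure of \<open>z\<close> means
        precisely \<open>?u {b} \<subseteq> ?u {z}\<close>.\<close>
      then show False
        unfolding rel_lower_star_def rel_upper_star_def by blast
    qed
    then show ?thesis
      using b phi unfolding \<psi>_def by blast
  qed
  moreover have "(x, y) \<in> \<phi>" if "(x, b) \<in> \<phi>" "(b, a) \<in> \<psi>" "(a, y) \<in> \<phi>" for x b a y
    using that phi unfolding \<psi>_def rel_upper_star_def by blast
  ultimately have "\<phi> O \<psi> O \<phi> = \<phi>"
    by (intro equalityI subrelI) (blast, meson relcomp.relcompI)
  moreover have "\<psi> \<subseteq> B \<times> A"
    unfolding \<psi>_def by blast
  ultimately show ?thesis
    unfolding regular_rel_def by blast
qed

theorem theorem1p2: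
  fixes A :: "'a set" and B :: "'b set" and \<phi> :: "('a \<times> 'b) set"
  assumes "\<phi> \<subseteq> A \<times> B"
  shows "regular_rel A B \<phi> \<longleftrightarrow> ccd (K_lattice A B \<phi>)"
  using assms regular_rel_imp_ccd ccd_imp_regular_rel by blast

end
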